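(* For every $\varepsilon>0$ there exists an integer $C(\varepsilon)\ge 3$ such that for all integers $d\ge C(\varepsilon)$ and $N\ge C(\varepsilon)d$ we have \[ \frac{1}{\#\Omega}\cdot\#\left\{(\mathbf v,\mathbf w)\in\Omega:\ \operatorname{dist}_d(\mathbf v,\mathbf w)\in\left[\tfrac{1}{\sqrt6}-\varepsilon,\ \tfrac{1}{\sqrt6}+\varepsilon\right]\right\}\ \ge\ 1-\varepsilon . \]
   Context: For integers $d,N\ge1$ let $\mathcal W=[0,N]^d\cap\mathbb Z^d$. For $\mathbf v=(v_1,\dots,v_d),\mathbf w=(w_1,\dots,w_d)\in\mathcal W$, the normalized distance is $\operatorname{dist}_d(\mathbf v,\mathbf w)=\frac{1}{N d^{1/2}}\big(\sum_{n=1}^d (w_n-v_n)^2\big)^{1/2}$. Two points are visible from each other if $\gcd(v_1-w_1,\dots,v_d-w_d)=1$, and $\Omega\subset\mathcal W\times\mathcal W$ is the set of ordered pairs $(\mathbf v,\mathbf w)$ of points visible from each other. *)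

theory Defs
  imports "HOL-Analysis.Analysis" "HOL-Library.FuncSet"
begin

(* A point of Z^d is a function on {1..d} that is "undefined" outside {1..d}, so that
   the box is a finite set of cardinality (N + 1) ^ d. *)
definition box_points :: "nat \<Rightarrow> nat \<Rightarrow> (nat \<Rightarrow> int) set" where
  "box_points d N = (\<Pi>\<^sub>E n\<in>{1..d}. {0..int N})"

definition normalized_dist :: "nat \<Rightarrow> nat \<Rightarrow> (nat \<Rightarrow> int) \<Rightarrow> (nat \<Rightarrow> int) \<Rightarrow> real" where
  "normalized_dist d N v w =
     1 / (real N * sqrt (real d)) * sqrt (\<Sum>n=1..d. (real_of_int (w n - v n))\<^sup>2)"

definition visible :: "nat \<Rightarrow> (nat \<Rightarrow> int) \<Rightarrow> (nat \<Rightarrow> int) \<Rightarrow> bool" where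
  "visible d v w \<longleftrightarrow> (GCD n\<in>{1..d}. v n - w n) = 1"

definition visible_pairs :: "nat \<Rightarrow> nat \<Rightarrow> ((nat \<Rightarrow> int) \<times> (nat \<Rightarrow> int)) set" where
  "visible_pairs d N = {(v, w) \<in> box_points d N \<times> box_points d N. visible d v w}"

end

theory Submission
  imports Defs
begin

text \<open>
  For a uniformly random pair of points the squared distance is a sum of \<open>d\<close> independent terms,
  each of mean \<open>N (N + 2) / 6\<close> and of variance at most \<open>N ^ 4\<close>, so by Chebyshev's inequality the
  normalized distance is within \<open>\<epsilon>\<close> of \<open>1 / sqrt 6\<close> outside a proportion \<open>O(1 / (d \<epsilon>\<^sup>2))\<close> of all
  pairs. This survives conditioning on visibility because at least half of all pairs are visible:
  the coordinate differences are all divisible by \<open>k \<ge> 2\<close> for a proportion of pairs that is at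
  most \<open>(1 / k + 1 / (N + 1)) ^ d\<close>, and these proportions have a small sum when \<open>d\<close> is large.
\<close>

section \<open>Product sets and independent coordinates\<close>

lemma sum_PiE_single:
  fixes f :: "'s \<Rightarrow> real"
  assumes "finite I" "finite S" "m \<in> I"
  shows "(\<Sum>u\<in>(\<Pi>\<^sub>E i\<in>I. S). f (u m)) = (\<Sum>s\<in>S. f s) * real (card S) ^ (card I - 1)"
proof -
  \<comment> \<open>Padding with the factor 1 off \<open>m\<close> makes the summand a product over
    all coordinates, so the sum over the product set factorises.\<close>
  let ?g = "\<lambda>i s. if i = m then f s else 1"
  have "(\<Sum>u\<in>(\<Pi>\<^sub>E i\<in>I. S). f (u m)) = (\<Sum>u\<in>(\<Pi>\<^sub>E i\<in>I. S). \<Prod>i\<in>I. ?g i (u i))"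
    using assms by simp
  also have "\<dots> = (\<Prod>i\<in>I. \<Sum>s\<in>S. ?g i s)"
    using prod_sum_PiE[of I "\<lambda>_. S" ?g] assms by simp
  also have "\<dots> = (\<Sum>s\<in>S. f s) * (\<Prod>i\<in>I - {m}. \<Sum>s\<in>S. ?g i s)"
    using assms by (subst prod.remove[of I m]) auto
  also have "(\<Prod>i\<in>I - {m}. \<Sum>s\<in>S. ?g i s) = real (card S) ^ (card I - 1)"
    using assms by simp
  finally show ?thesis .
qed

text \<open>Two distinct coordinates are uncorrelated: after factorisation, the factor belonging to
  \<open>m\<close> is the sum of \<open>f\<close> over \<open>S\<close>, which is 0.\<close>

lemma sum_PiE_mixed:
  fixes f :: "'s \<Rightarrow> real"
  assumes "finite I" "finite S" "m \<in> I" "n \<in> I" "m \<noteq> n" "(\<Sum>s\<in>S. f s) = 0"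
  shows "(\<Sum>u\<in>(\<Pi>\<^sub>E i\<in>I. S). f (u m) * f (u n)) = 0"
proof -
  let ?g = "\<lambda>i s. (if i = m then f s else 1) * (if i = n then f s else 1)"
  have "(\<Sum>u\<in>(\<Pi>\<^sub>E i\<in>I. S). f (u m) * f (u n)) = (\<Sum>u\<in>(\<Pi>\<^sub>E i\<in>I. S). \<Prod>i\<in>I. ?g i (u i))"
    using assms by (simp add: prod.distrib)
  also have "\<dots> = (\<Prod>i\<in>I. \<Sum>s\<in>S. ?g i s)"
    using prod_sum_PiE[of I "\<lambda>_. S" ?g] assms by simp
  also have "\<dots> = 0"
    using assms by (intro prod_zero bexI[of _ m]) auto
  finally show ?thesis .
qed

text \<open>Variances of independent centred terms add up. Expanding the square leaves only the
  diagonal terms, and each of these is at most \<open>B\<close> on average.\<close>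

lemma sum_PiE_second_moment:
  fixes f :: "'s \<Rightarrow> real"
  assumes "finite I" "finite S" "(\<Sum>s\<in>S. f s) = 0" "\<And>s. s \<in> S \<Longrightarrow> (f s)\<^sup>2 \<le> B"
  shows "(\<Sum>u\<in>(\<Pi>\<^sub>E i\<in>I. S). (\<Sum>i\<in>I. f (u i))\<^sup>2) \<le> real (card I) * B * real (card S) ^ card I"
proof -
  have diag: "(\<Sum>u\<in>(\<Pi>\<^sub>E i\<in>I. S). (f (u m))\<^sup>2) \<le> B * real (card S) ^ card I" if m: "m \<in> I" for m
  proof -
    \<comment> \<open>Nonemptiness of \<open>I\<close> lets the truncated exponent
      \<open>card I - 1\<close> absorb one more factor \<open>card S\<close>.\<close>
    have "card I > 0" using m assms by (auto simp: card_gt_0_iff)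
    then have pw: "real (card S) * real (card S) ^ (card I - 1) = real (card S) ^ card I"
      by (cases "card I") auto
    have "(\<Sum>u\<in>(\<Pi>\<^sub>E i\<in>I. S). (f (u m))\<^sup>2) = (\<Sum>s\<in>S. (f s)\<^sup>2) * real (card S) ^ (card I - 1)"
      using sum_PiE_single[of I S m "\<lambda>s. (f s)\<^sup>2"] assms m by simp
    also have "\<dots> \<le> (real (card S) * B) * real (card S) ^ (card I - 1)"
      using sum_bounded_above[of S "\<lambda>s. (f s)\<^sup>2" B] assms by (intro mult_right_mono) auto
    finally show ?thesis using pw by (simp add: algebra_simps)
  qed
  have inner: "(\<Sum>n\<in>I. \<Sum>u\<in>(\<Pi>\<^sub>E i\<in>I. S). f (u m) * f (u n)) = (\<Sum>u\<in>(\<Pi>\<^sub>E i\<in>I. S). (f (u m))\<^sup>2)"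
    if m: "m \<in> I" for m
  proof -
    have "(\<Sum>u\<in>(\<Pi>\<^sub>E i\<in>I. S). f (u m) * f (u n)) = 0" if "n \<in> I - {m}" for n
      using sum_PiE_mixed[of I S m n f] assms m that by auto
    then show ?thesis
      using assms m by (simp add: sum.remove[of I m] power2_eq_square)
  qed
  have "(\<Sum>u\<in>(\<Pi>\<^sub>E i\<in>I. S). (\<Sum>i\<in>I. f (u i))\<^sup>2)
      = (\<Sum>u\<in>(\<Pi>\<^sub>E i\<in>I. S). \<Sum>m\<in>I. \<Sum>n\<in>I. f (u m) * f (u n))"
    by (simp add: power2_eq_square sum_product)
  also have "\<dots> = (\<Sum>m\<in>I. \<Sum>n\<in>I. \<Sum>u\<in>(\<Pi>\<^sub>E i\<in>I. S). f (u m) * f (u n))"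
    by (subst sum.swap, intro sum.cong refl sum.swap)
  also have "\<dots> \<le> (\<Sum>m\<in>I. B * real (card S) ^ card I)"
    using inner diag by (intro sum_mono) simp
  finally show ?thesis by simp
qed

text \<open>Zipping turns a pair of points into a single point whose coordinates are pairs. A
  condition imposed coordinate by coordinate then describes a product set, to which the independence
  results apply.\<close>

lemma bij_betw_PiE_pairs:
  "bij_betw (\<lambda>(v, w). \<lambda>i\<in>I. (v i, w i))
     {(v, w) \<in> extensional I \<times> extensional I. \<forall>i\<in>I. (v i, w i) \<in> R} (\<Pi>\<^sub>E i\<in>I. R)"
  by (rule bij_betw_byWitness[where f' = "\<lambda>u. (\<lambda>i\<in>I. fst (u i), \<lambda>i\<in>I. snd (u i))"])
    (auto simp: fun_eq_iff extensional_def PiE_iff split: prod.splits)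

lemma card_PiE_pairs:
  assumes "finite I"
  shows "card {(v, w) \<in> extensional I \<times> extensional I. \<forall>i\<in>I. (v i, w i) \<in> R} = card R ^ card I"
  unfolding bij_betw_same_card[OF bij_betw_PiE_pairs] using card_PiE[OF assms, of "\<lambda>_. R"] by simp

section \<open>Sums and counts over one coordinate\<close>

lemma sum_int_atLeastAtMost:
  "(\<Sum>x\<in>{0..int N}. real_of_int x) = real N * (real N + 1) / 2"
proof (induction N)
  case (Suc N)
  have "{0..int (Suc N)} = insert (int (Suc N)) {0..int N}" by auto
  with Suc show ?case by (simp add: field_simps)
qed simp

lemma sum_int_squares_atLeastAtMost:
  "(\<Sum>x\<in>{0..int N}. (real_of_int x)\<^sup>2) = real N * (real N + 1) * (2 * real N + 1) / 6"
proof (induction N)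
  case (Suc N)
  have "{0..int (Suc N)} = insert (int (Suc N)) {0..int N}" by auto
  with Suc show ?case by (simp add: field_simps power2_eq_square)
qed simp

text \<open>Identifies the mean of one squared coordinate difference as N (N + 2) / 6. Its leading
  term N^2 / 6 is the origin of the constant 1 / sqrt 6.\<close>

lemma sum_squared_differences:
  "(\<Sum>(x, y)\<in>{0..int N} \<times> {0..int N}. (real_of_int (y - x))\<^sup>2)
    = (real N + 1)\<^sup>2 * (real N * (real N + 2) / 6)"
proof -
  let ?S = "{0..int N}"
  let ?r = "\<lambda>x::int. real_of_int x"
  have "(\<Sum>(x, y)\<in>?S \<times> ?S. (?r (y - x))\<^sup>2)
      = (\<Sum>x\<in>?S. \<Sum>y\<in>?S. (?r y)\<^sup>2 + (?r x)\<^sup>2 - 2 * (?r x * ?r y))"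
    by (simp add: sum.cartesian_product power2_diff algebra_simps)
  also have "\<dots> = 2 * (real N + 1) * (\<Sum>x\<in>?S. (?r x)\<^sup>2) - 2 * (\<Sum>x\<in>?S. ?r x)\<^sup>2"
    by (simp add: sum.distrib sum_subtractf power2_eq_square[of "sum _ _"]
        flip: sum_distrib_left sum_distrib_right)
  also have "\<dots> = (real N + 1)\<^sup>2 * (real N * (real N + 2) / 6)"
    unfolding sum_int_atLeastAtMost sum_int_squares_atLeastAtMost
    by (simp add: field_simps power2_eq_square)
  finally show ?thesis .
qed

text \<open>For fixed \<open>x\<close> the admissible \<open>y\<close> share one residue modulo
  \<open>k\<close>, so each is determined by its quotient \<open>y div k\<close>, which lies between
  0 and \<open>N div k\<close>.\<close>

lemma card_congruent_pairs:
  assumes "k \<ge> 1"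
  shows "card {(x, y) \<in> {0..int N} \<times> {0..int N}. int k dvd x - y} \<le> (N + 1) * (N div k + 1)"
proof -
  have *: "card {y \<in> {0..int N}. int k dvd x - y} \<le> N div k + 1" for x
  proof -
    have "inj_on (\<lambda>y. y div int k) {y \<in> {0..int N}. int k dvd x - y}"
    proof (rule inj_onI, clarify)
      fix y z assume "int k dvd x - y" "int k dvd x - z" and q: "y div int k = z div int k"
      then have "y mod int k = z mod int k"
        by (metis mod_eq_dvd_iff)
      with q show "y = z" by (metis div_mult_mod_eq)
    qed
    moreover have "(\<lambda>y. y div int k) ` {y \<in> {0..int N}. int k dvd x - y} \<subseteq> {0..int (N div k)}"
      using assms by (auto simp: zdiv_int zdiv_mono1 pos_imp_zdiv_nonneg_iff)
    ultimately have "card {y \<in> {0..int N}. int k dvd x - y} \<le> card {0..int (N div k)}"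
      by (rule card_inj_on_le) simp
    then show ?thesis by simp
  qed
  have "{(x, y) \<in> {0..int N} \<times> {0..int N}. int k dvd x - y}
      = (SIGMA x:{0..int N}. {y \<in> {0..int N}. int k dvd x - y})" by auto
  then have "card {(x, y) \<in> {0..int N} \<times> {0..int N}. int k dvd x - y}
      = (\<Sum>x\<in>{0..int N}. card {y \<in> {0..int N}. int k dvd x - y})" by (simp del: atLeastAtMost_iff mem_Collect_eq)
  also have "\<dots> \<le> (\<Sum>x\<in>{0..int N}. N div k + 1)" by (intro sum_mono *)
  finally show ?thesis by (simp add: nat_add_distrib)
qed

section \<open>Counting pairs in the box\<close>

lemma finite_box_points: "finite (box_points d N)"
  by (simp add: box_points_def finite_PiE)

lemma card_box_points: "card (box_points d N) = (N + 1) ^ d"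
  by (simp add: box_points_def card_PiE nat_add_distrib)

lemma box_points_pairs_eq:
  "{(v, w) \<in> box_points d N \<times> box_points d N. \<forall>n\<in>{1..d}. (v n, w n) \<in> R}
    = {(v, w) \<in> extensional {1..d} \<times> extensional {1..d}.
        \<forall>n\<in>{1..d}. (v n, w n) \<in> {0..int N} \<times> {0..int N} \<inter> R}"
  by (auto simp: box_points_def PiE_iff)

lemma card_box_points_pairs:
  "card {(v, w) \<in> box_points d N \<times> box_points d N. \<forall>n\<in>{1..d}. (v n, w n) \<in> R}
    = card ({0..int N} \<times> {0..int N} \<inter> R) ^ d"
  unfolding box_points_pairs_eq by (subst card_PiE_pairs) auto

section \<open>At least half of all pairs are visible\<close>

lemma sum_inverse_squares_from_2:
  "N \<ge> 1 \<Longrightarrow> (\<Sum>k=2..N. 1 / (real k)\<^sup>2) \<le> 1 - 1 / real N"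
proof (induction N rule: dec_induct)
  case (step n)
  \<comment> \<open>Comparison with a telescoping series.\<close>
  have "1 / (real (Suc n))\<^sup>2 \<le> 1 / (real n * real (Suc n))"
    using step by (intro divide_left_mono) (auto simp: power2_eq_square)
  also have "\<dots> = 1 / real n - 1 / real (Suc n)"
    using step by (simp add: field_simps)
  finally show ?case using step by simp
qed simp

text \<open>Each coordinate contributes a proportion of at most \<open>r\<close>. Two of the
  \<open>d\<close> factors are bounded by 2 / k, which makes the bound summable over
  \<open>k\<close>; the remaining \<open>d - 2\<close> are bounded by 2 / 3, which gives decay in
  \<open>d\<close>.\<close>

lemma card_divisible_pairs_le:
  assumes "2 \<le> k" "k \<le> N" "N \<ge> 5" "d \<ge> 2"
  shows "real (card {(v, w) \<in> box_points d N \<times> box_points d N. \<forall>n\<in>{1..d}. int k dvd v n - w n})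
    \<le> real (N + 1) ^ (2 * d) * (2 / 3) ^ (d - 2) * (4 / (real k)\<^sup>2)"
proof -
  define r where "r = 1 / real k + 1 / real (N + 1)"
  have r0: "r \<ge> 0" by (simp add: r_def)
  have "1 / real (N + 1) \<le> 1 / real k" using assms by (intro divide_left_mono) auto
  then have r1: "r \<le> 2 / real k" by (simp add: r_def)
  \<comment> \<open>The constant 2 / 3 is 1 / 2 + 1 / 6, from k \<ge> 2 and N \<ge> 5.\<close>
  have "1 / real k \<le> 1 / 2" "1 / real (N + 1) \<le> 1 / 6"
    using assms by (auto intro!: divide_left_mono)
  then have r2: "r \<le> 2 / 3" unfolding r_def by linarith
  have "card ({0..int N} \<times> {0..int N} \<inter> {(x, y). int k dvd x - y})
      = card {(x, y) \<in> {0..int N} \<times> {0..int N}. int k dvd x - y}"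
    by (rule arg_cong[where f = card]) auto
  also have "real \<dots> \<le> real ((N + 1) * (N div k + 1))"
    using card_congruent_pairs[of k N] assms by (subst of_nat_le_iff) simp
  \<comment> \<open>Enlarging \<open>N\<close> to \<open>N + 1\<close> in the quotient makes the
    bound exactly (N + 1)^2 times \<open>r\<close>.\<close>
  also have "\<dots> \<le> real (N + 1) * (real (N + 1) / real k + 1)"
    using of_nat_div_le_of_nat[of N k, where ?'a = real] divide_right_mono[of "real N" "real (N + 1)" "real k"]
    by (simp only: of_nat_mult) (intro mult_left_mono, auto)
  also have "\<dots> = real (N + 1) ^ 2 * r"
    by (simp add: r_def power2_eq_square distrib_left del: of_nat_add of_nat_Suc)
  finally have "real (card ({0..int N} \<times> {0..int N} \<inter> {(x, y). int k dvd x - y})) ^ d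
      \<le> (real (N + 1) ^ 2 * r) ^ d" by (intro power_mono) auto
  also have "\<dots> = real (N + 1) ^ (2 * d) * (r ^ (d - 2) * r\<^sup>2)"
    unfolding power_mult_distrib power_mult
    using power_add[of r "d - 2" 2] le_add_diff_inverse2[OF \<open>d \<ge> 2\<close>] by (simp only:)
  also have "\<dots> \<le> real (N + 1) ^ (2 * d) * ((2 / 3) ^ (d - 2) * (2 / real k)\<^sup>2)"
    using r0 r1 r2 by (intro mult_left_mono mult_mono power_mono) auto
  finally show ?thesis
    using card_box_points_pairs[of d N "{(x, y). int k dvd x - y}"]
    by (simp add: power_divide mult.assoc)
qed

text \<open>Treats the pairs with gcd 0. Their proportion (N + 1)^(-d) is weakened to the factor (2
  / 3)^(d - 2), so that it can be added to the bounds for the divisors \<open>k\<close>.\<close>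

lemma card_diagonal_pairs_le:
  assumes "N \<ge> 1" "d \<ge> 2"
  shows "real (card {(v, w) \<in> box_points d N \<times> box_points d N. \<forall>n\<in>{1..d}. v n = w n})
    \<le> real (N + 1) ^ (2 * d) * (2 / 3) ^ (d - 2)"
proof -
  have "{0..int N} \<times> {0..int N} \<inter> {(x, y). x = y} = (\<lambda>x. (x, x)) ` {0..int N}" by auto
  then have "card ({0..int N} \<times> {0..int N} \<inter> {(x, y). x = y}) = N + 1"
    by (simp add: card_image inj_on_def nat_add_distrib)
  then have "card {(v, w) \<in> box_points d N \<times> box_points d N. \<forall>n\<in>{1..d}. v n = w n} = (N + 1) ^ d"
    using card_box_points_pairs[of d N "{(x, y). x = y}"] by simp
  also have "real ((N + 1) ^ d) = real (N + 1) ^ (2 * d) * (1 / real (N + 1)) ^ d"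
    by (simp add: power_divide mult_2 power_add)
  also have "(1 / real (N + 1)) ^ d \<le> (2 / 3) ^ d"
    using assms by (intro power_mono) (auto simp: field_simps)
  also have "(2 / 3 :: real) ^ d \<le> (2 / 3) ^ (d - 2)"
    by (rule power_decreasing) auto
  finally show ?thesis by simp
qed

text \<open>Take \<open>k\<close> to be the gcd. Off the diagonal it divides a nonzero difference of
  absolute value at most \<open>N\<close>, so it lies in 1..N, and invisibility excludes 1.\<close>

lemma not_visible_cases:
  assumes "v \<in> box_points d N" "w \<in> box_points d N" "\<not> visible d v w"
  obtains "\<forall>n\<in>{1..d}. v n = w n"
  | k where "2 \<le> k" "k \<le> N" "\<forall>n\<in>{1..d}. int k dvd v n - w n"
proof -
  define g where "g = (GCD n\<in>{1..d}. v n - w n)"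
  have dvd: "g dvd v n - w n" if "n \<in> {1..d}" for n
    unfolding g_def by (rule Gcd_dvd) (use that in auto)
  have "g \<ge> 0" unfolding g_def by simp
  have "g \<noteq> 1" using assms(3) by (simp add: visible_def g_def)
  show thesis
  proof (cases "\<forall>n\<in>{1..d}. v n = w n")
    case False
    then obtain m where m: "m \<in> {1..d}" "v m \<noteq> w m" by blast
    have "v m \<in> {0..int N}" "w m \<in> {0..int N}"
      using assms(1,2) m(1) by (auto simp: box_points_def PiE_iff)
    then have "\<bar>v m - w m\<bar> \<le> int N" by auto
    moreover have "\<bar>g\<bar> \<le> \<bar>v m - w m\<bar>"
      using dvd[OF m(1)] m(2) by (intro dvd_imp_le_int) auto
    moreover have "g \<noteq> 0" using dvd[OF m(1)] m(2) by auto
    ultimately have "2 \<le> nat g" "nat g \<le> N" using \<open>g \<ge> 0\<close> \<open>g \<noteq> 1\<close> by auto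
    moreover have "\<forall>n\<in>{1..d}. int (nat g) dvd v n - w n" using dvd \<open>g \<ge> 0\<close> by simp
    ultimately show thesis by (rule that(2))
  qed (rule that(1))
qed

text \<open>Union bound for the invisible pairs, over the diagonal and the divisors \<open>k\<close>
  from 2 to \<open>N\<close>.\<close>

lemma card_visible_pairs_ge:
  assumes "d \<ge> 8" "N \<ge> 5"
  shows "real (card (visible_pairs d N)) \<ge> real (N + 1) ^ (2 * d) / 2"
proof -
  let ?B = "box_points d N \<times> box_points d N"
  let ?T = "real (N + 1) ^ (2 * d)"
  let ?c = "?T * (2 / 3) ^ (d - 2)"
  define D where "D = {(v, w) \<in> ?B. \<forall>n\<in>{1..d}. v n = w n}"
  define A where "A k = {(v, w) \<in> ?B. \<forall>n\<in>{1..d}. int k dvd v n - w n}" for k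
  have fin: "finite ?B" by (simp add: finite_box_points)
  have finA: "finite D" "finite (A k)" for k
    by (rule finite_subset[OF _ fin], force simp: D_def A_def)+
  have sub: "visible_pairs d N \<subseteq> ?B" by (auto simp: visible_pairs_def)
  have "?B - visible_pairs d N \<subseteq> D \<union> (\<Union>k\<in>{2..N}. A k)"
  proof clarify
    fix v w assume vw: "v \<in> box_points d N" "w \<in> box_points d N" "(v, w) \<notin> visible_pairs d N"
      "(v, w) \<notin> (\<Union>k\<in>{2..N}. A k)"
    from vw(1-3) have "\<not> visible d v w" by (auto simp: visible_pairs_def)
    with vw(1,2) show "(v, w) \<in> D"
      by (rule not_visible_cases) (use vw in \<open>auto simp: D_def A_def\<close>)
  qed
  then have "card (?B - visible_pairs d N) \<le> card (D \<union> (\<Union>k\<in>{2..N}. A k))"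
    using finA by (intro card_mono) auto
  also have "\<dots> \<le> card D + card (\<Union>k\<in>{2..N}. A k)" by (rule card_Un_le)
  also have "\<dots> \<le> card D + (\<Sum>k=2..N. card (A k))"
    by (intro add_left_mono card_UN_le) simp
  finally have "real (card (?B - visible_pairs d N)) \<le> real (card D) + (\<Sum>k=2..N. real (card (A k)))"
    by (metis of_nat_add of_nat_le_iff of_nat_sum)
  also have "\<dots> \<le> ?c + (\<Sum>k=2..N. ?c * (4 / (real k)\<^sup>2))"
    unfolding D_def A_def using assms
    by (intro add_mono sum_mono card_diagonal_pairs_le card_divisible_pairs_le) auto
  also have "\<dots> = ?c * (1 + 4 * (\<Sum>k=2..N. 1 / (real k)\<^sup>2))"
    by (simp add: sum_distrib_left distrib_left)
  also have "\<dots> \<le> ?c * 5"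
  proof (intro mult_left_mono)
    have "(\<Sum>k=2..N. 1 / (real k)\<^sup>2) \<le> 1 - 1 / real N"
      using assms by (intro sum_inverse_squares_from_2) simp
    also have "\<dots> \<le> 1" by simp
    finally show "1 + 4 * (\<Sum>k=2..N. 1 / (real k)\<^sup>2) \<le> 5" by simp
  qed simp
  also have "\<dots> \<le> ?T / 2"
  proof -
    \<comment> \<open>Here d \<ge> 8 enters: (2 / 3)^6 = 64 / 729 is below 1 / 10, which compensates
      the factor 5 and leaves 1 / 2.\<close>
    have "(2 / 3 :: real) ^ (d - 2) \<le> (2 / 3) ^ 6"
      using assms by (intro power_decreasing) auto
    also have "\<dots> \<le> 1 / 10" by (simp add: power_divide)
    finally have "?T * (2 / 3) ^ (d - 2) \<le> ?T * (1 / 10)" by (intro mult_left_mono) auto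
    then show ?thesis by simp
  qed
  finally have "real (card (?B - visible_pairs d N)) \<le> ?T / 2" .
  moreover have "real (card (?B - visible_pairs d N)) = ?T - real (card (visible_pairs d N))"
  proof -
    have "card (visible_pairs d N) \<le> card ?B" using fin sub by (intro card_mono) auto
    then show ?thesis
      using fin sub by (subst card_Diff_subset)
        (auto intro: finite_subset simp: card_cartesian_product card_box_points of_nat_diff mult_2 power_add)
  qed
  ultimately show ?thesis by linarith
qed

section \<open>Concentration of the squared distance\<close>

lemma second_moment_box_points:
  assumes "N \<ge> 1"
  shows "(\<Sum>(v, w)\<in>box_points d N \<times> box_points d N.
      ((\<Sum>n=1..d. (real_of_int (w n - v n))\<^sup>2) - real d * (real N * (real N + 2) / 6))\<^sup>2)
    \<le> real d * real N ^ 4 * real (N + 1) ^ (2 * d)"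
proof -
  let ?S = "{0..int N} \<times> {0..int N}"
  define \<mu> where "\<mu> = real N * (real N + 2) / 6"
  define f where "f = (\<lambda>(x::int, y::int). (real_of_int (y - x))\<^sup>2 - \<mu>)"
  have cardS: "real (card ?S) = real (N + 1) ^ 2"
    by (simp add: card_cartesian_product nat_add_distrib power2_eq_square algebra_simps)
  have mean: "(\<Sum>s\<in>?S. f s) = 0"
    using sum_squared_differences[of N] cardS
    by (simp add: f_def case_prod_unfold sum_subtractf \<mu>_def)
  \<comment> \<open>The mean and the squared difference both lie in [0, N^2], so the centred term is
    at most N^2 in absolute value.\<close>
  have "\<mu> \<le> (real N)\<^sup>2" "\<mu> \<ge> 0"
    using assms mult_left_mono[of 1 "real N" "real N"] by (auto simp: \<mu>_def power2_eq_square field_simps)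
  then have bound: "(f s)\<^sup>2 \<le> real N ^ 4" if s: "s \<in> ?S" for s
  proof -
    obtain x y where xy: "s = (x, y)" by fastforce
    have "\<bar>real_of_int (y - x)\<bar> \<le> real N" using s xy by auto
    then have "(real_of_int (y - x))\<^sup>2 \<le> (real N)\<^sup>2" by (metis abs_le_square_iff abs_of_nat)
    then have "\<bar>f s\<bar> \<le> (real N)\<^sup>2"
      using \<open>\<mu> \<le> (real N)\<^sup>2\<close> \<open>\<mu> \<ge> 0\<close> zero_le_power2[of "real_of_int (y - x)"]
      unfolding f_def xy by (simp only: prod.case)
    then have "\<bar>f s\<bar>\<^sup>2 \<le> ((real N)\<^sup>2)\<^sup>2" by (intro power_mono) auto
    then show ?thesis by (simp flip: power_mult)
  qed
  have dom: "box_points d N \<times> box_points d N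
      = {(v, w) \<in> extensional {1..d} \<times> extensional {1..d}. \<forall>n\<in>{1..d}. (v n, w n) \<in> ?S}"
    using box_points_pairs_eq[of d N UNIV] by auto
  \<comment> \<open>The constant \<open>\<mu>\<close> is distributed over the \<open>d\<close>
    coordinates, and the summand is expressed through the zipped point in order to reindex.\<close>
  have "(\<Sum>(v, w)\<in>box_points d N \<times> box_points d N.
      ((\<Sum>n=1..d. (real_of_int (w n - v n))\<^sup>2) - real d * \<mu>)\<^sup>2)
    = (\<Sum>p\<in>box_points d N \<times> box_points d N.
        (\<Sum>n=1..d. f ((case p of (v, w) \<Rightarrow> \<lambda>i\<in>{1..d}. (v i, w i)) n))\<^sup>2)"
    by (intro sum.cong refl) (auto simp: f_def sum_subtractf)
  also have "\<dots> = (\<Sum>u\<in>(\<Pi>\<^sub>E i\<in>{1..d}. ?S). (\<Sum>n=1..d. f (u n))\<^sup>2)"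
    unfolding dom by (rule sum.reindex_bij_betw[OF bij_betw_PiE_pairs])
  also have "\<dots> \<le> real (card {1..d}) * real N ^ 4 * real (card ?S) ^ card {1..d}"
    by (rule sum_PiE_second_moment) (use mean bound in auto)
  finally show ?thesis unfolding cardS \<mu>_def power_mult by simp
qed

text \<open>Chebyshev's inequality in counting form.\<close>

lemma card_deviating_le:
  fixes F :: "'a \<Rightarrow> real"
  assumes "finite A" "t > 0"
  shows "real (card {p \<in> A. \<bar>F p\<bar> \<ge> t}) \<le> (\<Sum>p\<in>A. (F p)\<^sup>2) / t\<^sup>2"
proof -
  have "real (card {p \<in> A. \<bar>F p\<bar> \<ge> t}) * t\<^sup>2 = (\<Sum>p | p \<in> A \<and> \<bar>F p\<bar> \<ge> t. t\<^sup>2)" by simp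
  also have "\<dots> \<le> (\<Sum>p | p \<in> A \<and> \<bar>F p\<bar> \<ge> t. (F p)\<^sup>2)"
    using assms by (intro sum_mono) (auto simp: abs_le_square_iff[symmetric])
  also have "\<dots> \<le> (\<Sum>p\<in>A. (F p)\<^sup>2)"
    using assms by (intro sum_mono2) auto
  finally show ?thesis using assms by (simp add: field_simps)
qed

text \<open>With \<delta> the distance and q = 1 / sqrt 6, the factorisation of \<delta>^2 - q^2 and
  q \<ge> 1 / 3 give a deviation of at least d N^2 \<epsilon> / 3 from d N^2 / 6. Passing to the
  exact mean shifts the centre by d N / 3, which costs at most half of this when N \<ge> 2 /
  \<epsilon>.\<close>

lemma squared_distance_deviation:
  assumes \<epsilon>: "\<epsilon> > 0" and N: "N \<ge> 1" "real N \<ge> 2 / \<epsilon>" and d: "d \<ge> 1"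
    and far: "normalized_dist d N v w \<notin> {1 / sqrt 6 - \<epsilon> .. 1 / sqrt 6 + \<epsilon>}"
  shows "\<bar>(\<Sum>n=1..d. (real_of_int (w n - v n))\<^sup>2) - real d * (real N * (real N + 2) / 6)\<bar>
    \<ge> real d * (real N)\<^sup>2 * \<epsilon> / 6"
proof -
  define X where "X = (\<Sum>n=1..d. (real_of_int (w n - v n))\<^sup>2)"
  define \<delta> where "\<delta> = normalized_dist d N v w"
  define q where "q = 1 / sqrt (6 :: real)"
  define K where "K = real d * (real N)\<^sup>2"
  have K: "K > 0" using N d by (simp add: K_def)
  have X0: "X \<ge> 0" unfolding X_def by (intro sum_nonneg) auto
  have \<delta>0: "\<delta> \<ge> 0" using X0 by (simp add: \<delta>_def normalized_dist_def X_def)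
  have "\<delta> = 1 / (real N * sqrt (real d)) * sqrt X"
    unfolding \<delta>_def normalized_dist_def X_def ..
  then have "\<delta>\<^sup>2 = X / K"
    using X0 by (simp add: K_def power_mult_distrib power_divide mult.commute)
  then have X: "X = K * \<delta>\<^sup>2" using K by simp
  have q2: "q\<^sup>2 = 1 / 6" by (simp add: q_def power_divide)
  have q3: "q \<ge> 1 / 3"
    unfolding q_def by (intro divide_left_mono real_le_lsqrt) auto
  have "\<bar>\<delta> - q\<bar> > \<epsilon>" using far by (auto simp: \<delta>_def q_def)
  then have "\<epsilon> * (1 / 3) \<le> \<bar>\<delta> - q\<bar> * (\<delta> + q)"
    using \<delta>0 q3 \<epsilon> by (intro mult_mono) auto
  also have "\<dots> = \<bar>\<delta>\<^sup>2 - q\<^sup>2\<bar>"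
    using \<delta>0 q3 by (simp add: power2_eq_square square_diff_square_factored abs_mult)
  finally have "K * (\<epsilon> / 3) \<le> K * \<bar>\<delta>\<^sup>2 - 1 / 6\<bar>" using K q2 by (intro mult_left_mono) auto
  also have "\<dots> = \<bar>X - K / 6\<bar>" using K by (simp add: X abs_mult_pos' algebra_simps)
  finally have 1: "\<bar>X - K / 6\<bar> \<ge> K * \<epsilon> / 3" by simp
  have 2: "real d * (real N * (real N + 2) / 6) = K / 6 + real d * real N / 3"
    by (simp add: K_def power2_eq_square field_simps)
  have "2 \<le> real N * \<epsilon>" using N(2) \<epsilon> by (simp add: field_simps)
  then have "real d * real N * 2 \<le> real d * real N * (real N * \<epsilon>)"
    by (intro mult_left_mono) auto
  then have 3: "real d * real N / 3 \<le> K * \<epsilon> / 6" by (simp add: K_def power2_eq_square algebra_simps)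
  have "real d * real N / 3 \<ge> 0" by simp
  with 1 2 3 have "\<bar>X - real d * (real N * (real N + 2) / 6)\<bar> \<ge> K * \<epsilon> / 6" by linarith
  then show ?thesis by (simp add: X_def K_def)
qed

lemma card_far_pairs_le:
  assumes \<epsilon>: "\<epsilon> > 0" and N: "N \<ge> 1" "real N \<ge> 2 / \<epsilon>" and d: "d \<ge> 1"
  shows "real (card {(v, w) \<in> box_points d N \<times> box_points d N.
      normalized_dist d N v w \<notin> {1 / sqrt 6 - \<epsilon> .. 1 / sqrt 6 + \<epsilon>}})
    \<le> 36 / (real d * \<epsilon>\<^sup>2) * real (N + 1) ^ (2 * d)"
proof -
  let ?B = "box_points d N \<times> box_points d N"
  define F where "F = (\<lambda>(v, w). (\<Sum>n=1..d. (real_of_int (w n - v n))\<^sup>2)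
    - real d * (real N * (real N + 2) / 6))"
  define t where "t = real d * (real N)\<^sup>2 * \<epsilon> / 6"
  have t: "t > 0" using assms by (simp add: t_def)
  have fin: "finite ?B" by (simp add: finite_box_points)
  have "card {(v, w) \<in> ?B. normalized_dist d N v w \<notin> {1 / sqrt 6 - \<epsilon> .. 1 / sqrt 6 + \<epsilon>}}
      \<le> card {p \<in> ?B. \<bar>F p\<bar> \<ge> t}"
    using squared_distance_deviation[OF assms] fin
    by (intro card_mono) (auto simp: F_def t_def)
  also have "real \<dots> \<le> (\<Sum>p\<in>?B. (F p)\<^sup>2) / t\<^sup>2"
    using fin t by (rule card_deviating_le)
  also have "\<dots> \<le> (real d * real N ^ 4 * real (N + 1) ^ (2 * d)) / t\<^sup>2"
    using second_moment_box_points[OF N(1), of d]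
    by (intro divide_right_mono) (auto simp: F_def case_prod_unfold)
  \<comment> \<open>The powers of \<open>N\<close> cancel against the threshold \<open>t\<close>,
    leaving a proportion that depends only on \<open>d\<close> and \<epsilon>.\<close>
  also have "\<dots> = 36 / (real d * \<epsilon>\<^sup>2) * real (N + 1) ^ (2 * d)"
    using assms by (simp add: t_def field_simps power2_eq_square power4_eq_xxxx)
  finally show ?thesis by simp
qed

theorem theorem1:
  fixes \<epsilon> :: real
  assumes "\<epsilon> > 0"
  shows "\<exists>C::nat. C \<ge> 3 \<and>
    (\<forall>d N :: nat. d \<ge> C \<longrightarrow> N \<ge> C * d \<longrightarrow>
      1 / real (card (visible_pairs d N)) *
        real (card {(v, w) \<in> visible_pairs d N.
          normalized_dist d N v w \<in> {1 / sqrt 6 - \<epsilon> .. 1 / sqrt 6 + \<epsilon>}})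
      \<ge> 1 - \<epsilon>)"
proof (intro exI[of _ "max 8 (nat \<lceil>72 / \<epsilon> ^ 3\<rceil> + nat \<lceil>2 / \<epsilon>\<rceil>)"] conjI allI impI)
  \<comment> \<open>The 8 serves the count of visible pairs, 72 / \<epsilon>^3 makes the Chebyshev
    proportion 36 / (d \<epsilon>^2) at most \<epsilon> / 2, and 2 / \<epsilon> controls the shift
    of the mean. Adding the two ceilings dominates both.\<close>
  define C where "C = max 8 (nat \<lceil>72 / \<epsilon> ^ 3\<rceil> + nat \<lceil>2 / \<epsilon>\<rceil>)"
  fix d N :: nat
  assume "max 8 (nat \<lceil>72 / \<epsilon> ^ 3\<rceil> + nat \<lceil>2 / \<epsilon>\<rceil>) \<le> d"
    "max 8 (nat \<lceil>72 / \<epsilon> ^ 3\<rceil> + nat \<lceil>2 / \<epsilon>\<rceil>) * d \<le> N"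
  then have dC: "C \<le> d" and NC: "C * d \<le> N" by (auto simp only: C_def)
  have C8: "C \<ge> 8" by (simp add: C_def)
  have "C * 1 \<le> C * d" using dC C8 by (intro mult_le_mono2) simp
  with NC have CN: "C \<le> N" by linarith
  have "72 / \<epsilon> ^ 3 \<le> real (nat \<lceil>72 / \<epsilon> ^ 3\<rceil>)" "2 / \<epsilon> \<le> real (nat \<lceil>2 / \<epsilon>\<rceil>)"
    by (rule real_nat_ceiling_ge)+
  then have "72 / \<epsilon> ^ 3 \<le> real C" "2 / \<epsilon> \<le> real C" by (auto simp: C_def)
  then have d\<epsilon>: "72 / \<epsilon> ^ 3 \<le> real d" and N\<epsilon>: "2 / \<epsilon> \<le> real N" using dC CN by linarith+
  let ?V = "visible_pairs d N"
  let ?near = "\<lambda>v w. normalized_dist d N v w \<in> {1 / sqrt 6 - \<epsilon> .. 1 / sqrt 6 + \<epsilon>}"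
  let ?T = "real (N + 1) ^ (2 * d)"
  let ?G = "{(v, w) \<in> ?V. ?near v w}"
  let ?F = "{(v, w) \<in> box_points d N \<times> box_points d N. \<not> ?near v w}"
  have fin: "finite (box_points d N \<times> box_points d N)" by (simp add: finite_box_points)
  have V: "real (card ?V) \<ge> ?T / 2" using dC CN C8 by (intro card_visible_pairs_ge) auto
  have Vpos: "real (card ?V) > 0" by (rule less_le_trans[OF _ V]) simp
  have "?V \<subseteq> ?G \<union> ?F" by (auto simp: visible_pairs_def)
  then have "card ?V \<le> card (?G \<union> ?F)"
    by (intro card_mono finite_subset[OF _ fin]) (auto simp: visible_pairs_def)
  also have "\<dots> \<le> card ?G + card ?F" by (rule card_Un_le)
  finally have "real (card ?V) \<le> real (card ?G) + real (card ?F)" by linarith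
  moreover have "real (card ?F) \<le> 36 / (real d * \<epsilon>\<^sup>2) * ?T"
    using assms N\<epsilon> dC CN C8 by (intro card_far_pairs_le) auto
  \<comment> \<open>A share \<epsilon> / 2 of all pairs is at most a share \<epsilon> of the visible
    ones, since these are at least half of all.\<close>
  moreover have "36 / (real d * \<epsilon>\<^sup>2) * ?T \<le> \<epsilon> / 2 * ?T"
    using d\<epsilon> assms dC C8 by (intro mult_right_mono) (auto simp: field_simps power2_eq_square power3_eq_cube)
  moreover have "\<epsilon> * (?T / 2) \<le> \<epsilon> * real (card ?V)" using V assms by (intro mult_left_mono) auto
  ultimately have "(1 - \<epsilon>) * real (card ?V) \<le> real (card ?G)" by (simp add: algebra_simps)
  then show "1 - \<epsilon> \<le> 1 / real (card ?V) * real (card ?G)"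
    using Vpos by (simp add: field_simps)
qed simp

end
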